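(* Let $d\in\mathbb{N}$ and let $\xi,\xi_1,\xi_2,\ldots$ be i.i.d. random variables in $\mathbb{R}^d$ with $\mathbb{E}\|\xi\|<\infty$ and $\mathbb{E}\xi=\mu$. Let $S_n:=\sum_{i=1}^n\xi_i$, $G_0:=0$ and $G_n:=\frac1n\sum_{i=1}^nS_i$ for $n\ge1$. Then, as $n\to\infty$, as elements of $(\mathcal{D}_0^d,\rho_S)$, $$\frac1n\big(G_{\lfloor nt\rfloor}\big)_{t\in[0,1]}\to\frac12 I_\mu\quad\text{almost surely},$$ where $I_\mu(t):=\mu t$ for $t\in[0,1]$.
   Context: $\mathcal{D}_0^d$ is the set of right-continuous functions $f:[0,1]\to\mathbb{R}^d$ with left-hand limits and $f(0)=0$. $\rho_S$ is the Skorokhod metric $\rho_S(f,g):=\inf_{\lambda\in\Lambda}\max\{\|\lambda-I\|_\infty,\|f-g\circ\lambda\|_\infty\}$, where $\Lambda$ is the set of strictly increasing continuous maps of $[0,1]$ onto itself, $I$ is the identity on $[0,1]$, and $\|\cdot\|_\infty$ is the supremum norm. Almost sure convergence $X_n\to X$ in a metric space $(S,\rho)$ means $\rho(X_n,X)\to0$ almost surely. *)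

theory Defs
  imports "HOL-Probability.Probability"
begin

text \<open>
  A function on the unit interval is represented by a total function on the reals; for members of
  the Skorokhod space the values outside the unit interval are fixed by \<^const>\<open>extensional\<close>, so that
  two members are equal iff they agree on the unit interval.
\<close>

definition skorokhod_D0 :: "(real \<Rightarrow> 'v::real_normed_vector) set" where
  "skorokhod_D0 = {f \<in> extensional {0..1}. f 0 = 0 \<and>
     (\<forall>t\<in>{0..<1}. (f \<longlongrightarrow> f t) (at_right t)) \<and>
     (\<forall>t\<in>{0<..1}. \<exists>l. (f \<longlongrightarrow> l) (at_left t))}"

definition time_changes :: "(real \<Rightarrow> real) set" where
  "time_changes = {\<tau>. strict_mono_on {0..1} \<tau> \<and> continuous_on {0..1} \<tau> \<and> \<tau> ` {0..1} = {0..1}}"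

text \<open>
  The supremum and infimum below are taken in the reals. They are the intended ones for arguments
  in \<^const>\<open>skorokhod_D0\<close> over a Euclidean space: such functions are bounded on the unit interval, and
  the set of which the infimum is taken is nonempty and bounded below by 0.
\<close>

definition sup_norm :: "(real \<Rightarrow> 'v::real_normed_vector) \<Rightarrow> real" where
  "sup_norm f = (SUP t\<in>{0..1}. norm (f t))"

definition skorokhod_dist ::
    "(real \<Rightarrow> 'v::real_normed_vector) \<Rightarrow> (real \<Rightarrow> 'v) \<Rightarrow> real" where
  "skorokhod_dist f g =
     (INF \<tau>\<in>time_changes. max (sup_norm (\<lambda>t. \<tau> t - t)) (sup_norm (\<lambda>t. f t - g (\<tau> t))))"

definition random_walk :: "(nat \<Rightarrow> 'w \<Rightarrow> 'v::real_vector) \<Rightarrow> nat \<Rightarrow> 'w \<Rightarrow> 'v" where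
  "random_walk X n \<omega> = (\<Sum>i=1..n. X i \<omega>)"

definition center_of_mass :: "(nat \<Rightarrow> 'w \<Rightarrow> 'v::real_vector) \<Rightarrow> nat \<Rightarrow> 'w \<Rightarrow> 'v" where
  "center_of_mass X n \<omega> =
     (if n = 0 then 0 else (1 / real n) *\<^sub>R (\<Sum>i=1..n. random_walk X i \<omega>))"

definition com_path :: "(nat \<Rightarrow> 'w \<Rightarrow> 'v::real_vector) \<Rightarrow> nat \<Rightarrow> 'w \<Rightarrow> real \<Rightarrow> 'v" where
  "com_path X n \<omega> =
     (\<lambda>t\<in>{0..1}. (1 / real n) *\<^sub>R center_of_mass X (nat \<lfloor>real n * t\<rfloor>) \<omega>)"

definition linear_path :: "'v::real_vector \<Rightarrow> real \<Rightarrow> 'v" where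
  "linear_path \<mu> = (\<lambda>t\<in>{0..1}. t *\<^sub>R \<mu>)"

end

theory Submission
  imports Defs
begin

text \<open>
  The strong law of large numbers gives \<open>S\<^sub>n / n \<rightarrow> \<mu>\<close> almost surely. On that event
  \<open>\<parallel>S\<^sub>i - i \<mu>\<parallel> \<le> \<epsilon> i + C\<close>, so averaging gives \<open>\<parallel>G\<^sub>k - k \<mu> / 2\<parallel> \<le> \<epsilon> k + C'\<close> for all \<open>k\<close>.
  Taking \<open>k = \<lfloor>n t\<rfloor> \<le> n\<close> and dividing by \<open>n\<close>, the convergence is even uniform in \<open>t\<close>, which
  dominates the Skorokhod distance.

  The strong law is proved in the manner of Etemadi. For nonnegative variables and \<open>k\<^sub>n = \<lceil>\<alpha>\<^sup>n\<rceil>\<close>,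
  the sum of the first \<open>k\<^sub>n\<close> variables is compared with the sum of the same variables clipped at
  \<open>k\<^sub>n\<close>. Both the probability that some variable is clipped and the Chebyshev bound for the clipped
  sum are controlled by \<open>E (min \<xi> k\<^sub>n)\<^sup>2 / k\<^sub>n\<close>, which is summable in \<open>n\<close> because \<open>\<xi>\<close> is
  integrable. Borel--Cantelli yields convergence along \<open>k\<^sub>n\<close>, and monotonicity of the partial sums
  together with \<open>\<alpha> \<down> 1\<close> yields it along all \<open>n\<close>.
\<close>

subsection \<open>The strong law of large numbers\<close>

text \<open>The terms split at the threshold \<open>x\<close>: while
  \<open>\<alpha> ^ n \<le> x\<close> they equal \<open>\<alpha> ^ n\<close>, afterwards
  \<open>x\<^sup>2 / \<alpha> ^ n\<close>. Both are geometric sums dominated by the terms nearest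
  the threshold, and each is at most \<open>\<alpha> / (\<alpha> - 1) * x\<close>.\<close>

lemma sum_squared_min_geometric_le:
  fixes \<alpha> x :: real
  assumes "\<alpha> > 1" "x \<ge> 0"
  shows "(\<Sum>n<N. (min x (\<alpha> ^ n))\<^sup>2 / \<alpha> ^ n) \<le> 2 * \<alpha> / (\<alpha> - 1) * x"
proof -
  have pos: "\<alpha> ^ n > 0" for n using assms by simp
  define A where "A n = (if \<alpha> ^ n \<le> x then \<alpha> ^ n else 0)" for n
  define B where "B n = (if \<alpha> ^ n \<le> x then 0 else x\<^sup>2 / \<alpha> ^ n)" for n
  \<comment> \<open>The bound acts as a potential: while \<open>\<alpha> ^ N \<le> x\<close> it
    grows by exactly \<open>(\<alpha> - 1) * \<alpha> ^ N\<close>, and later it does not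
    decrease.\<close>
  have A: "(\<alpha> - 1) * (\<Sum>n<N. A n) \<le> min (\<alpha> ^ N) (\<alpha> * x)"
  proof (induction N)
    case (Suc N)
    have "(\<alpha> - 1) * A N \<le> min (\<alpha> ^ Suc N) (\<alpha> * x) - min (\<alpha> ^ N) (\<alpha> * x)"
    proof (cases "\<alpha> ^ N \<le> x")
      case True
      then have "\<alpha> * \<alpha> ^ N \<le> \<alpha> * x" using assms by simp
      moreover have "\<alpha> ^ N \<le> \<alpha> * \<alpha> ^ N" using assms pos[of N] by simp
      ultimately show ?thesis using True by (simp add: A_def min_def algebra_simps)
    next
      case False
      have "\<alpha> ^ N \<le> \<alpha> ^ Suc N" using assms pos[of N] by simp
      then show ?thesis using False by (simp add: A_def min_def)
    qed
    then show ?case using Suc unfolding sum.lessThan_Suc distrib_left by linarith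
  qed (use assms in auto)
  \<comment> \<open>Again a potential: the minimum stays at \<open>x\<close> until the threshold is
    passed; from then on \<open>\<alpha>\<close> times its decrease is exactly
    \<open>(\<alpha> - 1) * B N\<close>.\<close>
  have B: "(\<alpha> - 1) * (\<Sum>n<N. B n) \<le> \<alpha> * (x - min x (x\<^sup>2 / \<alpha> ^ N))"
  proof (induction N)
    case 0
    then show ?case using assms by (simp add: min_def)
  next
    case (Suc N)
    have "(\<alpha> - 1) * B N \<le> \<alpha> * (min x (x\<^sup>2 / \<alpha> ^ N) - min x (x\<^sup>2 / \<alpha> ^ Suc N))"
    proof (cases "\<alpha> ^ N \<le> x")
      case True
      have "x\<^sup>2 / \<alpha> ^ Suc N \<le> x\<^sup>2 / \<alpha> ^ N"
        using assms pos[of N] by (intro divide_left_mono) auto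
      then show ?thesis using True assms by (simp add: B_def min_def)
    next
      case False
      have 1: "x\<^sup>2 / \<alpha> ^ N \<le> x" 
        using False assms pos[of N] mult_left_mono[of x "\<alpha>^N" x] by (simp add: divide_simps power2_eq_square)
      have 2: "x\<^sup>2 / \<alpha> ^ Suc N \<le> x\<^sup>2 / \<alpha> ^ N"
        using assms pos[of N] by (intro divide_left_mono) auto
      have "min x (x\<^sup>2 / \<alpha> ^ N) = x\<^sup>2 / \<alpha> ^ N" "min x (x\<^sup>2 / \<alpha> ^ Suc N) = x\<^sup>2 / \<alpha> ^ Suc N"
        using 1 2 by linarith+
      then show ?thesis using False assms pos[of N] by (simp add: B_def field_simps)
    qed
    then show ?case using Suc unfolding sum.lessThan_Suc distrib_left right_diff_distrib by linarith
  qed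
  have "(\<Sum>n<N. (min x (\<alpha> ^ n))\<^sup>2 / \<alpha> ^ n) = (\<Sum>n<N. A n) + (\<Sum>n<N. B n)"
    unfolding sum.distrib[symmetric]
    by (intro sum.cong refl) (use pos in \<open>auto simp: A_def B_def min_def power2_eq_square\<close>)
  also have "(\<alpha> - 1) * \<dots> \<le> \<alpha> * x + \<alpha> * x"
  proof -
    have "min x (x\<^sup>2 / \<alpha> ^ N) \<ge> 0" using assms pos[of N] by simp
    then have "\<alpha> * (x - min x (x\<^sup>2 / \<alpha> ^ N)) \<le> \<alpha> * x" using assms by simp
    with A B show ?thesis unfolding distrib_left by linarith
  qed
  finally show ?thesis using assms by (simp add: field_simps)
qed

text \<open>Since \<open>\<alpha> ^ n \<ge> 1\<close>, rounding up at most doubles it: the numerator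
  grows by a factor of at most 4, and the denominator does not shrink.\<close>

lemma sum_squared_min_ceiling_geometric_le:
  fixes \<alpha> x :: real
  assumes "\<alpha> > 1" "x \<ge> 0"
  shows "(\<Sum>n<N. (min x (real (nat \<lceil>\<alpha> ^ n\<rceil>)))\<^sup>2 / real (nat \<lceil>\<alpha> ^ n\<rceil>)) \<le> 8 * \<alpha> / (\<alpha> - 1) * x"
proof -
  have "(min x (real (nat \<lceil>\<alpha> ^ n\<rceil>)))\<^sup>2 / real (nat \<lceil>\<alpha> ^ n\<rceil>) \<le> 4 * ((min x (\<alpha> ^ n))\<^sup>2 / \<alpha> ^ n)" for n
  proof -
    have 1: "\<alpha> ^ n \<ge> 1" using assms by simp
    define k where "k = real (nat \<lceil>\<alpha> ^ n\<rceil>)"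
    have k: "k \<ge> \<alpha> ^ n" "k \<le> 2 * \<alpha> ^ n"
      using 1 unfolding k_def by linarith+
    have "(min x k)\<^sup>2 \<le> (2 * min x (\<alpha> ^ n))\<^sup>2"
      using k assms 1 by (intro power_mono) auto
    then have "(min x k)\<^sup>2 / k \<le> (2 * min x (\<alpha> ^ n))\<^sup>2 / \<alpha> ^ n"
      using k assms by (intro frac_le) auto
    then show ?thesis by (simp add: power_mult_distrib k_def)
  qed
  then have "(\<Sum>n<N. (min x (real (nat \<lceil>\<alpha> ^ n\<rceil>)))\<^sup>2 / real (nat \<lceil>\<alpha> ^ n\<rceil>))
      \<le> 4 * (\<Sum>n<N. (min x (\<alpha> ^ n))\<^sup>2 / \<alpha> ^ n)"
    unfolding sum_distrib_left by (rule sum_mono)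
  also have "\<dots> \<le> 4 * (2 * \<alpha> / (\<alpha> - 1) * x)"
    using sum_squared_min_geometric_le[OF assms] by (intro mult_left_mono) auto
  finally show ?thesis by (simp add: algebra_simps)
qed

section \<open>From geometric subsequences to all indices\<close>

lemma geometric_bracket:
  fixes \<alpha> x :: real
  assumes "\<alpha> > 1" "x \<ge> \<alpha> ^ n0"
  obtains n where "n \<ge> n0" "\<alpha> ^ n \<le> x" "x < \<alpha> ^ Suc n"
proof -
  have ex: "\<exists>p. x < \<alpha> ^ p" using real_arch_pow[OF assms(1)] .
  define p where "p = (LEAST p. x < \<alpha> ^ p)"
  have p: "x < \<alpha> ^ p" unfolding p_def by (rule LeastI_ex[OF ex])
  have "\<alpha> ^ n0 < \<alpha> ^ p" using p assms by linarith
  then have "n0 < p" using assms by (simp add: power_strict_increasing_iff)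
  then obtain n where n: "p = Suc n" "n0 \<le> n" by (cases p) auto
  have "\<not> x < \<alpha> ^ n" using not_less_Least[of n "\<lambda>p. x < \<alpha> ^ p"] n by (simp add: p_def)
  then show thesis using that n p by auto
qed

text \<open>Monotonicity traps \<open>s N\<close> between its values at the neighbours
  \<open>k n \<le> N \<le> k (Suc n)\<close>, whose ratio is about \<open>\<alpha>\<close>, at a
  relative cost of order \<open>\<alpha> - 1\<close>. Only the ratios
  \<open>1 + 1 / real (Suc m)\<close> are used, so that countably many almost sure events will
  suffice.\<close>

lemma mono_average_tendsto_along_geometric:
  fixes s :: "nat \<Rightarrow> real"
  assumes mono: "mono s" and nonneg: "\<And>n. 0 \<le> s n"
    and lim: "\<And>m. (\<lambda>n. s (nat \<lceil>(1 + 1 / real (Suc m)) ^ n\<rceil>) / real (nat \<lceil>(1 + 1 / real (Suc m)) ^ n\<rceil>)) \<longlonglongrightarrow> \<mu>"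
  shows "(\<lambda>n. s n / real n) \<longlonglongrightarrow> \<mu>"
proof (rule LIMSEQ_I)
  have \<mu>: "\<mu> \<ge> 0"
    using lim[of 0] nonneg by (intro LIMSEQ_le_const[OF lim[of 0]]) auto
  fix r :: real assume r: "r > 0"
  \<comment> \<open>This choice makes \<open>\<mu> * (\<alpha> - 1) \<le> r / 4\<close>, the price
    of replacing \<open>N\<close> by a neighbouring index.\<close>
  obtain m where m: "4 * \<mu> / r < real m" using reals_Archimedean2 by blast
  define \<alpha> where "\<alpha> = 1 + 1 / real (Suc m)"
  define k where "k n = nat \<lceil>\<alpha> ^ n\<rceil>" for n
  have \<alpha>: "\<alpha> > 1" "\<alpha> \<le> 2" by (auto simp: \<alpha>_def)
  have "4 * \<mu> \<le> real m * r" using mult_right_mono[OF less_imp_le[OF m], of r] r by simp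
  also have "\<dots> \<le> real (Suc m) * r" using r by simp
  finally have \<mu>\<alpha>: "\<mu> * (\<alpha> - 1) \<le> r / 4" by (simp add: \<alpha>_def field_simps)
  have pow1: "\<alpha> ^ n \<ge> 1" for n using \<alpha> by simp
  have k: "real (k n) \<ge> \<alpha> ^ n" "real (k n) \<le> \<alpha> ^ n + 1" for n
    unfolding k_def using pow1[of n] by linarith+
  have "(\<lambda>n. s (k n) / real (k n)) \<longlonglongrightarrow> \<mu>" unfolding k_def \<alpha>_def by (rule lim)
  then obtain n0 where n0: "\<And>n. n \<ge> n0 \<Longrightarrow> norm (s (k n) / real (k n) - \<mu>) < r / 8"
    using LIMSEQ_D[of "\<lambda>n. s (k n) / real (k n)" \<mu> "r / 8"] r by auto
  have dev: "\<bar>s (k n) - \<mu> * k n\<bar> \<le> r / 8 * k n" if "n \<ge> n0" for n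
  proof -
    have pos: "real (k n) > 0" using k(1)[of n] pow1[of n] by linarith
    have "s (k n) - \<mu> * k n = (s (k n) / real (k n) - \<mu>) * k n" using pos by (simp add: field_simps)
    then have "\<bar>s (k n) - \<mu> * k n\<bar> = \<bar>s (k n) / real (k n) - \<mu>\<bar> * k n" by (simp add: abs_mult)
    also have "\<dots> \<le> r / 8 * k n" using n0[OF that] by (intro mult_right_mono) auto
    finally show ?thesis .
  qed
  \<comment> \<open>The summand \<open>\<alpha> ^ n0\<close> forces the bracketing exponent to be at
    least \<open>n0\<close>; the rest lets \<open>r / 2 * N\<close> absorb the additive error
    \<open>\<mu> + r / 2\<close>, which covers the rounding in \<open>k\<close>.\<close>
  obtain N0 where N0: "real N0 \<ge> \<alpha> ^ n0 + 2 * \<mu> / r + 1" using real_arch_simple by blast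
  have "norm (s N / real N - \<mu>) < r" if "N \<ge> N0" for N
  proof -
    have frac: "2 * \<mu> / r \<ge> 0" using \<mu> r by simp
    have N: "real N \<ge> \<alpha> ^ n0" "real N \<ge> 2 * \<mu> / r + 1" 
      using N0 frac pow1[of n0] of_nat_mono[OF that, where 'a=real] by linarith+
    have "2 * \<mu> / r * (r / 2) \<le> (real N - 1) * (r / 2)" using N(2) r by (intro mult_right_mono) auto
    then have Nr: "\<mu> + r / 2 \<le> r / 2 * real N" "real N \<ge> 1" using r frac N(2) by (auto simp: algebra_simps)
    obtain n where n: "n \<ge> n0" "\<alpha> ^ n \<le> N" "N < \<alpha> ^ Suc n"
      using geometric_bracket[OF \<alpha>(1) N(1)] by blast
    have kN: "k n \<le> N" unfolding k_def using n(2) by (simp add: nat_le_iff ceiling_le_iff)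
    have Nk: "N \<le> k (Suc n)" using n(3) k(1)[of "Suc n"] by linarith
    have k': "real (k (Suc n)) \<le> \<alpha> * N + 1"
    proof -
      have "\<alpha> * \<alpha> ^ n \<le> \<alpha> * N" using n(2) \<alpha> by (intro mult_left_mono) auto
      then show ?thesis using k(2)[of "Suc n"] by simp
    qed
    have "s N \<le> s (k (Suc n))" using monoD[OF mono Nk] .
    also have "\<dots> \<le> (\<mu> + r / 8) * k (Suc n)" using dev[of "Suc n"] n(1) unfolding distrib_right by (simp only: abs_le_iff) linarith
    also have "\<dots> \<le> (\<mu> + r / 8) * (\<alpha> * N + 1)" using k' \<mu> r by (intro mult_left_mono) auto
    also have "\<dots> = \<mu> * N + \<mu> * (\<alpha> - 1) * N + \<mu> + r / 8 * (\<alpha> * N) + r / 8" by (simp add: algebra_simps)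
    also have "\<dots> \<le> \<mu> * N + r / 4 * N + \<mu> + r / 8 * (2 * N) + r / 8"
      using \<mu>\<alpha> \<alpha> r by (intro add_mono mult_right_mono mult_left_mono order_refl) (auto simp: mult_right_mono)
    also have "\<dots> < \<mu> * N + r * N" using Nr r by (simp add: algebra_simps)
    finally have upper: "s N < \<mu> * N + r * N" .
    \<comment> \<open>The tangent \<open>2 - \<alpha>\<close> to \<open>1 / \<alpha>\<close> at 1
      lies below it, so \<open>N / \<alpha>\<close> gets a lower bound that is linear in
      \<open>\<alpha>\<close>.\<close>
    have "\<alpha> * (2 - \<alpha>) \<le> 1" using zero_le_power2[of "\<alpha> - 1"] by (simp add: power2_eq_square algebra_simps)
    then have "\<alpha> * (2 - \<alpha>) * N \<le> 1 * real N" by (rule mult_right_mono) simp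
    also have "\<dots> \<le> \<alpha> * \<alpha> ^ n" using n(3) by simp
    finally have "(2 - \<alpha>) * N \<le> \<alpha> ^ n" using \<alpha> by (simp add: mult.assoc)
    then have "(2 - \<alpha>) * N \<le> k n" using k(1)[of n] by linarith
    then have "\<mu> * ((2 - \<alpha>) * N) \<le> \<mu> * k n" using \<mu> by (rule mult_left_mono)
    moreover have "\<mu> * (\<alpha> - 1) * N \<le> r / 4 * N" using \<mu>\<alpha> by (rule mult_right_mono) simp
    moreover have "r / 8 * k n \<le> r / 8 * N" using kN r by simp
    moreover have "s (k n) \<le> s N" using monoD[OF mono kN] .
    moreover have "\<mu> * k n - r / 8 * k n \<le> s (k n)" using dev[OF n(1)] by linarith
    moreover have "\<mu> * ((2 - \<alpha>) * N) = \<mu> * N - \<mu> * (\<alpha> - 1) * N" by (simp add: algebra_simps)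
    moreover have "r * N > 0" using r Nr by simp
    ultimately have lower: "s N > \<mu> * N - r * N" by linarith
    have "\<bar>s N - \<mu> * N\<bar> < r * N" using upper lower by linarith
    moreover have "s N / N - \<mu> = (s N - \<mu> * N) / N" using Nr by (simp add: field_simps)
    ultimately show ?thesis using Nr by (simp add: field_simps)
  qed
  then show "\<exists>N0. \<forall>N\<ge>N0. norm (s N / real N - \<mu>) < r" by blast
qed

section \<open>Deviation bounds and the strong law\<close>

context prob_space
begin

text \<open>Bienayme's identity: each new summand is independent of the sum of the others and
  centred, so the cross term vanishes. Integrability is carried through the same induction because
  additivity of the integral relies on it.\<close>

lemma expectation_square_sum_indep_centered:
  fixes C :: "'i \<Rightarrow> 'a \<Rightarrow> real"
  assumes "finite I" "indep_vars (\<lambda>_. borel) C I"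
    and "\<And>i. i \<in> I \<Longrightarrow> integrable M (C i)"
    and "\<And>i. i \<in> I \<Longrightarrow> integrable M (\<lambda>\<omega>. (C i \<omega>)\<^sup>2)"
    and "\<And>i. i \<in> I \<Longrightarrow> expectation (C i) = 0"
  shows "integrable M (\<lambda>\<omega>. (\<Sum>i\<in>I. C i \<omega>)\<^sup>2) \<and>
    expectation (\<lambda>\<omega>. (\<Sum>i\<in>I. C i \<omega>)\<^sup>2) = (\<Sum>i\<in>I. expectation (\<lambda>\<omega>. (C i \<omega>)\<^sup>2))"
  using assms
proof (induction I)
  case (insert i I)
  have "indep_vars (\<lambda>_. borel) C I"
    by (rule indep_vars_subset[OF insert.prems(1)]) auto
  then have IH: "integrable M (\<lambda>\<omega>. (\<Sum>i\<in>I. C i \<omega>)\<^sup>2)"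
      "expectation (\<lambda>\<omega>. (\<Sum>i\<in>I. C i \<omega>)\<^sup>2) = (\<Sum>i\<in>I. expectation (\<lambda>\<omega>. (C i \<omega>)\<^sup>2))"
    using insert.IH insert.prems by auto
  have ind: "indep_var borel (C i) borel (\<lambda>\<omega>. \<Sum>j\<in>I. C j \<omega>)"
    using insert by (intro indep_vars_sum) auto
  have int: "integrable M (C i)" "integrable M (\<lambda>\<omega>. \<Sum>j\<in>I. C j \<omega>)"
    using insert.prems by auto
  note cross = indep_var_integrable[OF ind int] indep_var_lebesgue_integral[OF ind int]
  have zero: "expectation (\<lambda>\<omega>. C i \<omega> * (\<Sum>j\<in>I. C j \<omega>)) = 0"
    using cross insert.prems by simp
  have eq: "(\<Sum>j\<in>insert i I. C j \<omega>)\<^sup>2 = (C i \<omega>)\<^sup>2 + 2 * (C i \<omega> * (\<Sum>j\<in>I. C j \<omega>)) + (\<Sum>j\<in>I. C j \<omega>)\<^sup>2" for \<omega>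
    using insert by (simp add: power2_sum)
  show ?case unfolding eq using insert cross zero IH by simp
qed simp

text \<open>A large deviation from the clipped mean means that some variable reaches
  \<open>k\<close> or that the centred clipped sum is large. With \<open>q\<close> the clipped
  second moment, Markov's inequality and a union bound give \<open>q / k\<close> for the former,
  Chebyshev's inequality gives \<open>q / (\<epsilon>\<^sup>2 * k)\<close> for the latter.\<close>

lemma prob_sum_iid_deviation_le:
  fixes X :: "nat \<Rightarrow> 'a \<Rightarrow> real"
  assumes indep: "indep_vars (\<lambda>_. borel) X {1..}"
    and [measurable]: "\<xi> \<in> borel_measurable M"
    and dist: "\<And>i. i \<ge> 1 \<Longrightarrow> distr M borel (X i) = distr M borel \<xi>"
    and nonneg: "\<And>i \<omega>. i \<ge> 1 \<Longrightarrow> 0 \<le> X i \<omega>" "\<And>\<omega>. 0 \<le> \<xi> \<omega>"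
    and "k \<ge> 1" "\<epsilon> > 0"
  shows "prob {\<omega> \<in> space M. \<bar>(\<Sum>i=1..k. X i \<omega>) - real k * expectation (\<lambda>\<omega>. min (\<xi> \<omega>) k)\<bar> \<ge> \<epsilon> * k}
    \<le> (1 + 1 / \<epsilon>\<^sup>2) * expectation (\<lambda>\<omega>. (min (\<xi> \<omega>) k)\<^sup>2 / k)"
proof -
  have Xm: "X i \<in> borel_measurable M" if "i \<ge> 1" for i
    using indep that by (auto simp: indep_vars_def)
  have transfer: "expectation (\<lambda>\<omega>. f (X i \<omega>)) = expectation (\<lambda>\<omega>. f (\<xi> \<omega>))"
    if "i \<ge> 1" and [measurable]: "f \<in> borel_measurable borel" for i and f :: "real \<Rightarrow> real"
    using integral_distr[OF Xm[OF that(1)] that(2)] integral_distr[of \<xi> M borel f] dist[OF that(1)] that by simp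
  define e where "e = expectation (\<lambda>\<omega>. min (\<xi> \<omega>) k)"
  define q where "q = expectation (\<lambda>\<omega>. (min (\<xi> \<omega>) k)\<^sup>2)"
  have bnd: "norm (min y k) \<le> k" "norm ((min y k)\<^sup>2) \<le> (real k)\<^sup>2" if "y \<ge> 0" for y :: real
    using that by (auto intro: power_mono)
  have int\<xi>: "integrable M (\<lambda>\<omega>. min (\<xi> \<omega>) k)" "integrable M (\<lambda>\<omega>. (min (\<xi> \<omega>) k)\<^sup>2)"
    by (rule integrable_const_bound[where B="real k"], use bnd nonneg in simp, measurable)
      (rule integrable_const_bound[where B="(real k)\<^sup>2"], use bnd nonneg in simp, measurable)
  have intX: "integrable M (\<lambda>\<omega>. min (X i \<omega>) k)" "integrable M (\<lambda>\<omega>. (min (X i \<omega>) k)\<^sup>2)" if "i \<ge> 1" for i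
    using Xm[OF that]
    by (rule_tac integrable_const_bound[where B="real k"], use bnd nonneg that in simp, measurable)
      (rule integrable_const_bound[where B="(real k)\<^sup>2"], use bnd nonneg that in simp, use Xm[OF that] in measurable)
  have eX: "expectation (\<lambda>\<omega>. min (X i \<omega>) k) = e" "expectation (\<lambda>\<omega>. (min (X i \<omega>) k)\<^sup>2) = q" if "i \<ge> 1" for i
    unfolding e_def q_def by (rule transfer[OF that], measurable)+
  define C where "C i \<omega> = min (X i \<omega>) k - e" for i \<omega>
  have C: "integrable M (C i)" "integrable M (\<lambda>\<omega>. (C i \<omega>)\<^sup>2)" "expectation (C i) = 0"
      "expectation (\<lambda>\<omega>. (C i \<omega>)\<^sup>2) \<le> q" if "i \<ge> 1" for i
  proof -
    note I = intX[OF that] eX[OF that]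
    show "integrable M (C i)" unfolding C_def using I by simp
    have eq: "(C i \<omega>)\<^sup>2 = (min (X i \<omega>) k)\<^sup>2 - 2 * e * min (X i \<omega>) k + e\<^sup>2" for \<omega>
      by (simp add: C_def power2_diff algebra_simps)
    show "integrable M (\<lambda>\<omega>. (C i \<omega>)\<^sup>2)" unfolding eq using I by simp
    show "expectation (C i) = 0" unfolding C_def using I by (simp add: prob_space)
    have "expectation (\<lambda>\<omega>. (C i \<omega>)\<^sup>2) = q - 2 * e * e + e\<^sup>2"
      unfolding eq using I by (simp add: prob_space)
    then show "expectation (\<lambda>\<omega>. (C i \<omega>)\<^sup>2) \<le> q" by (simp add: power2_eq_square)
  qed
  have indC: "indep_vars (\<lambda>_. borel) C {1..k}"
    unfolding C_def
    by (rule indep_vars_compose2[where M'="\<lambda>_. borel" and Y="\<lambda>_ x. min x (real k) - e", OF indep_vars_subset[OF indep]]) auto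
  have sumC: "integrable M (\<lambda>\<omega>. (\<Sum>i=1..k. C i \<omega>)\<^sup>2)"
     "expectation (\<lambda>\<omega>. (\<Sum>i=1..k. C i \<omega>)\<^sup>2) = (\<Sum>i=1..k. expectation (\<lambda>\<omega>. (C i \<omega>)\<^sup>2))"
    using expectation_square_sum_indep_centered[OF _ indC] C by auto
  have sumC_le: "expectation (\<lambda>\<omega>. (\<Sum>i=1..k. C i \<omega>)\<^sup>2) \<le> k * q"
    unfolding sumC(2) using sum_mono[of "{1..k}" "\<lambda>i. expectation (\<lambda>\<omega>. (C i \<omega>)\<^sup>2)" "\<lambda>_. q"] C by simp
  have Cm [measurable]: "(\<lambda>\<omega>. \<Sum>i=1..k. C i \<omega>) \<in> borel_measurable M"
    using C by (intro borel_measurable_sum) auto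
  \<comment> \<open>For nonnegative \<open>X i\<close> this is the event
    \<open>X i \<omega> \<ge> k\<close>; the squared form is what Markov's inequality for the second
    moment takes.\<close>
  define U where "U i = {\<omega> \<in> space M. (min (X i \<omega>) k)\<^sup>2 \<ge> (real k)\<^sup>2}" for i
  define V where "V = {\<omega> \<in> space M. (\<Sum>i=1..k. C i \<omega>)\<^sup>2 \<ge> (\<epsilon> * k)\<^sup>2}"
  have Um: "U i \<in> events" if "i \<ge> 1" for i
    unfolding U_def using Xm[OF that] by measurable
  have Vm: "V \<in> events" unfolding V_def by measurable
  have kpos: "real k > 0" using assms by simp
  have PU: "prob (U i) \<le> q / k\<^sup>2" if "i \<ge> 1" for i
  proof -
    have "prob (U i) \<le> expectation (\<lambda>\<omega>. (min (X i \<omega>) k)\<^sup>2) / (real k)\<^sup>2"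
      unfolding U_def using intX[OF that] kpos by (intro integral_Markov_inequality_measure[where A="{}"]) auto
    then show ?thesis using eX[OF that] by simp
  qed
  have "prob V \<le> expectation (\<lambda>\<omega>. (\<Sum>i=1..k. C i \<omega>)\<^sup>2) / (\<epsilon> * k)\<^sup>2"
    unfolding V_def using sumC kpos \<open>\<epsilon> > 0\<close> by (intro integral_Markov_inequality_measure[where A="{}"]) auto
  also have "\<dots> \<le> (k * q) / (\<epsilon> * k)\<^sup>2"
    using sumC_le by (intro divide_right_mono) auto
  finally have PV: "prob V \<le> 1 / \<epsilon>\<^sup>2 * (q / k)"
    using kpos \<open>\<epsilon> > 0\<close> by (simp add: power2_eq_square field_simps)
  let ?E = "{\<omega> \<in> space M. \<bar>(\<Sum>i=1..k. X i \<omega>) - real k * e\<bar> \<ge> \<epsilon> * k}"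
  have sub: "?E \<subseteq> (\<Union>i\<in>{1..k}. U i) \<union> V"
  proof
    fix \<omega> assume \<omega>: "\<omega> \<in> ?E"
    show "\<omega> \<in> (\<Union>i\<in>{1..k}. U i) \<union> V"
    proof (cases "\<exists>i\<in>{1..k}. X i \<omega> \<ge> k")
      case True
      then obtain i where "i \<in> {1..k}" "X i \<omega> \<ge> k" by blast
      then have "\<omega> \<in> U i" using \<omega> by (simp add: U_def min_absorb2)
      then show ?thesis using \<open>i \<in> {1..k}\<close> by blast
    next
      \<comment> \<open>Without a variable reaching \<open>k\<close>, clipping changes nothing and
        the deviation is exactly that of the centred clipped sum.\<close>
      case False
      then have "(\<Sum>i=1..k. C i \<omega>) = (\<Sum>i=1..k. X i \<omega> - e)"
        by (intro sum.cong) (force simp: C_def min_def)+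
      then have "\<bar>\<Sum>i=1..k. C i \<omega>\<bar> \<ge> \<epsilon> * k" using \<omega> by (simp add: sum_subtractf)
      then have "\<bar>\<epsilon> * k\<bar> \<le> \<bar>\<Sum>i=1..k. C i \<omega>\<bar>" using \<open>\<epsilon> > 0\<close> by (simp add: abs_mult)
      then show ?thesis using \<omega> unfolding V_def abs_le_square_iff by auto
    qed
  qed
  have Umm: "(\<Union>i\<in>{1..k}. U i) \<in> events" using Um by auto
  have "prob (\<Union>i\<in>{1..k}. U i) \<le> (\<Sum>i=1..k. prob (U i))"
    using Um by (intro measure_UNION_le) auto
  also have "\<dots> \<le> (\<Sum>i=1..k. q / k\<^sup>2)"
    using PU by (intro sum_mono) auto
  also have "\<dots> = q / k" using kpos by (simp add: power2_eq_square)
  finally have "prob (\<Union>i\<in>{1..k}. U i) \<le> q / k" .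
  moreover have "prob ?E \<le> prob ((\<Union>i\<in>{1..k}. U i) \<union> V)"
    using Umm Vm by (intro finite_measure_mono sub) auto
  moreover have "prob ((\<Union>i\<in>{1..k}. U i) \<union> V) \<le> prob (\<Union>i\<in>{1..k}. U i) + prob V"
    using Umm Vm by (intro measure_Un_le)
  ultimately have "prob ?E \<le> (1 + 1 / \<epsilon>\<^sup>2) * (q / k)" using PV unfolding distrib_right by linarith
  then show ?thesis by (simp add: e_def q_def)
qed

lemma strong_law_nonneg:
  fixes X :: "nat \<Rightarrow> 'a \<Rightarrow> real"
  assumes indep: "indep_vars (\<lambda>_. borel) X {1..}"
    and int: "integrable M \<xi>"
    and dist: "\<And>i. i \<ge> 1 \<Longrightarrow> distr M borel (X i) = distr M borel \<xi>"
    and nonneg: "\<And>i \<omega>. i \<ge> 1 \<Longrightarrow> 0 \<le> X i \<omega>" "\<And>\<omega>. 0 \<le> \<xi> \<omega>"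
  shows "AE \<omega> in M. (\<lambda>n. (\<Sum>i=1..n. X i \<omega>) / real n) \<longlonglongrightarrow> expectation \<xi>"
proof -
  have [measurable]: "\<xi> \<in> borel_measurable M" using int by auto
  define S where "S n \<omega> = (\<Sum>i=1..n. X i \<omega>)" for n \<omega>
  define e where "e k = expectation (\<lambda>\<omega>. min (\<xi> \<omega>) (real k))" for k :: nat
  define K where "K m n = nat \<lceil>(1 + 1 / real (Suc m)) ^ n\<rceil>" for m n
  \<comment> \<open>The deviation event at ratio \<open>1 + 1 / (m + 1)\<close>, accuracy
    \<open>1 / (j + 1)\<close> and position \<open>n\<close> of the subsequence; countable index
    sets keep the final intersection almost sure.\<close>
  define D where "D m j n = {\<omega> \<in> space M. \<bar>S (K m n) \<omega> - K m n * e (K m n)\<bar> \<ge> 1 / real (Suc j) * K m n}" for m j n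
  have K_ge: "real (K m n) \<ge> (1 + 1 / real (Suc m)) ^ n" for m n
    unfolding K_def by linarith
  have K1: "K m n \<ge> 1" for m n
  proof -
    have "(1 + 1 / real (Suc m)) ^ n \<ge> 1" by (intro one_le_power) auto
    then show ?thesis using K_ge[of m n] by linarith
  qed
  have Xm: "X i \<in> borel_measurable M" if "i \<ge> 1" for i
    using indep that by (auto simp: indep_vars_def)
  have Sm [measurable]: "S n \<in> borel_measurable M" for n
    unfolding S_def using Xm by (intro borel_measurable_sum) auto
  have Dm: "D m j n \<in> events" for m j n unfolding D_def by measurable
  have summ: "summable (\<lambda>n. prob (D m j n))" for m j
  proof (rule summableI_nonneg_bounded)
    fix N
    let ?\<alpha> = "1 + 1 / real (Suc m)" and ?c = "1 + 1 / (1 / real (Suc j))\<^sup>2"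
    let ?h = "\<lambda>n \<omega>. (min (\<xi> \<omega>) (K m n))\<^sup>2 / K m n"
    have inth: "integrable M (?h n)" for n
    proof -
      have "integrable M (\<lambda>\<omega>. (min (\<xi> \<omega>) (K m n))\<^sup>2)"
        by (rule integrable_const_bound[where B="(real (K m n))\<^sup>2"])
          (use nonneg in \<open>auto intro: power_mono\<close>)
      then show ?thesis by simp
    qed
    have "(\<Sum>n<N. prob (D m j n)) \<le> (\<Sum>n<N. ?c * expectation (?h n))"
      unfolding D_def S_def e_def
      by (intro sum_mono prob_sum_iid_deviation_le[OF indep _ dist nonneg K1]) auto
    also have "\<dots> = ?c * expectation (\<lambda>\<omega>. \<Sum>n<N. ?h n \<omega>)"
      using inth by (simp add: sum_distrib_left Bochner_Integration.integral_sum del: integral_divide_zero)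
    \<comment> \<open>With the finite sum inside the expectation, the bound for geometric sequences
      applies pointwise to \<open>\<xi> \<omega>\<close>; its constant is independent of
      \<open>N\<close>.\<close>
    also have "\<dots> \<le> ?c * expectation (\<lambda>\<omega>. 8 * ?\<alpha> / (?\<alpha> - 1) * \<xi> \<omega>)"
    proof (intro mult_left_mono integral_mono)
      show "(\<Sum>n<N. ?h n \<omega>) \<le> 8 * ?\<alpha> / (?\<alpha> - 1) * \<xi> \<omega>" for \<omega>
        unfolding K_def by (rule sum_squared_min_ceiling_geometric_le) (use nonneg in auto)
    qed (use inth int in auto)
    finally show "(\<Sum>n<N. prob (D m j n)) \<le> ?c * expectation (\<lambda>\<omega>. 8 * ?\<alpha> / (?\<alpha> - 1) * \<xi> \<omega>)" .
  qed simp
  have AE_D: "AE \<omega> in M. eventually (\<lambda>n. \<omega> \<in> space M - D m j n) sequentially" for m j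
    by (rule borel_cantelli_AE1[OF Dm _ summ]) (simp add: emeasure_eq_measure)
  \<comment> \<open>The deviations are measured from the clipped mean, so its convergence to the
    true mean is needed separately.\<close>
  have e_lim: "e \<longlonglongrightarrow> expectation \<xi>"
    unfolding e_def
  proof (rule integral_dominated_convergence[where w=\<xi>])
    show "AE \<omega> in M. (\<lambda>k. min (\<xi> \<omega>) (real k)) \<longlonglongrightarrow> \<xi> \<omega>"
    proof (intro AE_I2 tendsto_eventually)
      fix \<omega>
      obtain k0 where "\<xi> \<omega> \<le> real k0" using real_arch_simple by blast
      then show "\<forall>\<^sub>F k in sequentially. min (\<xi> \<omega>) (real k) = \<xi> \<omega>"
        unfolding eventually_sequentially by (intro exI[of _ k0]) auto
    qed
  qed (use int nonneg in auto)
  have "AE \<omega> in M. \<forall>m j. eventually (\<lambda>n. \<omega> \<in> space M - D m j n) sequentially"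
    using AE_D by (simp add: AE_all_countable)
  then show ?thesis
  proof (eventually_elim)
    case (elim \<omega>)
    have "(\<lambda>n. S n \<omega> / real n) \<longlonglongrightarrow> expectation \<xi>"
    proof (rule mono_average_tendsto_along_geometric)
      show "mono (\<lambda>n. S n \<omega>)" unfolding S_def
        by (intro monoI sum_mono2) (use nonneg in auto)
      show "0 \<le> S n \<omega>" for n unfolding S_def by (intro sum_nonneg) (use nonneg in auto)
      fix m
      have "filterlim (\<lambda>n. (1 + 1 / real (Suc m)) ^ n) at_top sequentially"
      proof (intro filterlim_at_top[THEN iffD2] allI)
        fix Z :: real
        obtain p where "Z < (1 + 1 / real (Suc m)) ^ p" using real_arch_pow[of "1 + 1 / real (Suc m)" Z] by auto
        then show "\<forall>\<^sub>F n in sequentially. Z \<le> (1 + 1 / real (Suc m)) ^ n"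
          unfolding eventually_sequentially
          by (intro exI[of _ p] allI impI) (meson less_imp_le order_trans power_increasing le_add_same_cancel1 zero_le_divide_1_iff of_nat_0_le_iff)
      qed
      then have "filterlim (\<lambda>n. real (K m n)) at_top sequentially"
        by (rule filterlim_at_top_mono) (use K_ge in auto)
      then have "filterlim (K m) sequentially sequentially"
        using filterlim_sequentially_iff_filterlim_real by blast
      then have eK: "(\<lambda>n. e (K m n)) \<longlonglongrightarrow> expectation \<xi>"
        using e_lim by (rule filterlim_compose[rotated])
      have "(\<lambda>n. S (K m n) \<omega> / K m n - e (K m n)) \<longlonglongrightarrow> 0"
      proof (rule LIMSEQ_I)
        fix r :: real assume "r > 0"
        then obtain j where j: "1 / real (Suc j) < r" using nat_approx_posE by blast
        have "\<forall>\<^sub>F n in sequentially. \<omega> \<in> space M - D m j n" using elim by blast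
        then have "\<forall>\<^sub>F n in sequentially. norm (S (K m n) \<omega> / K m n - e (K m n) - 0) < r"
        proof (eventually_elim)
          case (elim n)
          then have "\<bar>S (K m n) \<omega> - K m n * e (K m n)\<bar> < 1 / real (Suc j) * K m n"
            unfolding D_def by auto
          also have "\<dots> \<le> r * K m n" using j by (intro mult_right_mono) auto
          finally have *: "\<bar>S (K m n) \<omega> - K m n * e (K m n)\<bar> < r * K m n" .
          have "S (K m n) \<omega> / K m n - e (K m n) = (S (K m n) \<omega> - K m n * e (K m n)) / K m n"
            using K1[of m n] by (simp add: field_simps)
          then show ?case using * K1[of m n] by (simp add: field_simps)
        qed
        then show "\<exists>N. \<forall>n\<ge>N. norm (S (K m n) \<omega> / K m n - e (K m n) - 0) < r"
          by (simp add: eventually_sequentially)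
      qed
      from tendsto_add[OF this eK]
      show "(\<lambda>n. S (nat \<lceil>(1 + 1 / real (Suc m)) ^ n\<rceil>) \<omega> / real (nat \<lceil>(1 + 1 / real (Suc m)) ^ n\<rceil>)) \<longlonglongrightarrow> expectation \<xi>"
        by (simp add: K_def)
    qed
    then show ?case by (simp add: S_def)
  qed
qed

text \<open>Positive and negative parts are images under a fixed measurable function, hence again
  independent and identically distributed, and the nonnegative case applies to each.\<close>

lemma strong_law_real:
  fixes X :: "nat \<Rightarrow> 'a \<Rightarrow> real"
  assumes indep: "indep_vars (\<lambda>_. borel) X {1..}"
    and int: "integrable M \<xi>"
    and dist: "\<And>i. i \<ge> 1 \<Longrightarrow> distr M borel (X i) = distr M borel \<xi>"
  shows "AE \<omega> in M. (\<lambda>n. (\<Sum>i=1..n. X i \<omega>) / real n) \<longlonglongrightarrow> expectation \<xi>"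
proof -
  have [measurable]: "\<xi> \<in> borel_measurable M" using int by auto
  have Xm: "X i \<in> borel_measurable M" if "i \<ge> 1" for i
    using indep that by (auto simp: indep_vars_def)
  have nonneg_part: "AE \<omega> in M. (\<lambda>n. (\<Sum>i=1..n. f (X i \<omega>)) / real n) \<longlonglongrightarrow> expectation (\<lambda>\<omega>. f (\<xi> \<omega>))"
    if [measurable]: "f \<in> borel_measurable borel" and f: "\<And>x. 0 \<le> f x" "integrable M (\<lambda>\<omega>. f (\<xi> \<omega>))" for f :: "real \<Rightarrow> real"
  proof (rule strong_law_nonneg)
    show "indep_vars (\<lambda>_. borel) (\<lambda>i \<omega>. f (X i \<omega>)) {1..}"
      by (rule indep_vars_compose2[where Y="\<lambda>_. f", OF indep]) simp
    show "distr M borel (\<lambda>\<omega>. f (X i \<omega>)) = distr M borel (\<lambda>\<omega>. f (\<xi> \<omega>))" if "i \<ge> 1" for i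
      using distr_distr[of f borel borel "X i" M] distr_distr[of f borel borel \<xi> M] Xm[OF that] dist[OF that]
      by (simp add: comp_def)
  qed (use f in auto)
  have ints: "integrable M (\<lambda>\<omega>. max 0 (\<xi> \<omega>))" "integrable M (\<lambda>\<omega>. max 0 (- \<xi> \<omega>))" using int by auto
  have dec: "max 0 x - max 0 (- x) = x" for x :: real by (simp add: max_def)
  have "AE \<omega> in M. (\<lambda>n. (\<Sum>i=1..n. max 0 (X i \<omega>)) / real n) \<longlonglongrightarrow> expectation (\<lambda>\<omega>. max 0 (\<xi> \<omega>))"
    using ints by (intro nonneg_part) auto
  moreover have "AE \<omega> in M. (\<lambda>n. (\<Sum>i=1..n. max 0 (- X i \<omega>)) / real n) \<longlonglongrightarrow> expectation (\<lambda>\<omega>. max 0 (- \<xi> \<omega>))"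
    using ints by (intro nonneg_part) auto
  ultimately show ?thesis
  proof eventually_elim
    case (elim \<omega>)
    have "expectation (\<lambda>\<omega>. max 0 (\<xi> \<omega>)) - expectation (\<lambda>\<omega>. max 0 (- \<xi> \<omega>)) = expectation \<xi>"
      by (subst Bochner_Integration.integral_diff[OF ints, symmetric]) (simp add: dec)
    then show ?case
      using tendsto_diff[OF elim] by (simp add: diff_divide_distrib[symmetric] sum_subtractf[symmetric] dec)
  qed
qed

text \<open>Coordinates reduce the claim to the real case; the basis is finite, so the exceptional
  null sets combine.\<close>

lemma strong_law:
  fixes X :: "nat \<Rightarrow> 'a \<Rightarrow> 'v :: euclidean_space"
  assumes indep: "indep_vars (\<lambda>_. borel) X {1..}"
    and int: "integrable M \<xi>"
    and dist: "\<And>i. i \<ge> 1 \<Longrightarrow> distr M borel (X i) = distr M borel \<xi>"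
  shows "AE \<omega> in M. (\<lambda>n. (1 / real n) *\<^sub>R (\<Sum>i=1..n. X i \<omega>)) \<longlonglongrightarrow> expectation \<xi>"
proof -
  have [measurable]: "\<xi> \<in> borel_measurable M" using int by auto
  have Xm: "X i \<in> borel_measurable M" if "i \<ge> 1" for i
    using indep that by (auto simp: indep_vars_def)
  have "AE \<omega> in M. (\<lambda>n. (\<Sum>i=1..n. X i \<omega> \<bullet> b) / real n) \<longlonglongrightarrow> expectation (\<lambda>\<omega>. \<xi> \<omega> \<bullet> b)" for b
  proof (rule strong_law_real)
    show "indep_vars (\<lambda>_. borel) (\<lambda>i \<omega>. X i \<omega> \<bullet> b) {1..}"
      by (rule indep_vars_compose2[where Y="\<lambda>_ x. x \<bullet> b", OF indep]) simp
    show "distr M borel (\<lambda>\<omega>. X i \<omega> \<bullet> b) = distr M borel (\<lambda>\<omega>. \<xi> \<omega> \<bullet> b)" if "i \<ge> 1" for i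
      using distr_distr[of "\<lambda>x. x \<bullet> b" borel borel "X i" M] distr_distr[of "\<lambda>x. x \<bullet> b" borel borel \<xi> M] Xm[OF that] dist[OF that]
      by (simp add: comp_def)
  qed (use int in auto)
  then have "AE \<omega> in M. \<forall>b\<in>Basis. (\<lambda>n. (\<Sum>i=1..n. X i \<omega> \<bullet> b) / real n) \<longlonglongrightarrow> expectation (\<lambda>\<omega>. \<xi> \<omega> \<bullet> b)"
    by (intro AE_finite_allI) auto
  then show ?thesis
  proof eventually_elim
    case (elim \<omega>)
    show ?case
    proof (subst tendsto_componentwise_iff, intro ballI)
      fix b :: 'v assume "b \<in> Basis"
      then show "(\<lambda>n. ((1 / real n) *\<^sub>R (\<Sum>i=1..n. X i \<omega>)) \<bullet> b) \<longlonglongrightarrow> expectation \<xi> \<bullet> b"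
        using elim int by (simp add: inner_sum_left)
    qed
  qed
qed

end

subsection \<open>Paths and the Skorokhod distance\<close>

lemma step_path_in_skorokhod_D0:
  fixes g :: "nat \<Rightarrow> 'v::real_normed_vector"
  assumes "n \<ge> 1" "g 0 = 0"
  shows "(\<lambda>t\<in>{0..1}. g (nat \<lfloor>real n * t\<rfloor>)) \<in> skorokhod_D0"
proof -
  let ?f = "\<lambda>t\<in>{0..1}. g (nat \<lfloor>real n * t\<rfloor>)"
  have n: "real n > 0" using assms by simp
  have right: "(?f \<longlongrightarrow> ?f t) (at_right t)" if t: "t \<in> {0..<1}" for t
  proof -
    \<comment> \<open>The next jump after \<open>t\<close>, capped at the right end of the interval;
      up to it the floor is constant.\<close>
    let ?b = "min 1 ((of_int \<lfloor>real n * t\<rfloor> + 1) / real n)"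
    have b: "t < ?b" using t n by (simp add: pos_less_divide_eq mult.commute[of t] del: real_of_int_floor_add_one_gt) linarith
    have "\<forall>\<^sub>F y in at_right t. ?f y = ?f t"
      unfolding eventually_at_right[OF b]
    proof (intro exI[of _ ?b] conjI allI impI b)
      fix y assume y: "t < y" "y < ?b"
      have "real n * t \<le> real n * y" using y n by simp
      moreover have "real n * y < of_int \<lfloor>real n * t\<rfloor> + 1"
        using y n by (simp add: pos_less_divide_eq mult.commute)
      ultimately have "\<lfloor>real n * y\<rfloor> = \<lfloor>real n * t\<rfloor>" by (intro floor_unique) linarith+
      then show "?f y = ?f t" using y t by simp
    qed
    then show ?thesis by (rule tendsto_eventually)
  qed
  have left: "\<exists>l. (?f \<longlongrightarrow> l) (at_left t)" if t: "t \<in> {0<..1}" for t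
  proof -
    \<comment> \<open>The last jump strictly before \<open>t\<close>. Just left of \<open>t\<close>
      the floor is the ceiling of \<open>real n * t\<close> minus 1, also when \<open>t\<close>
      itself is a jump, where the floor at \<open>t\<close> would be one too large.\<close>
    let ?b = "max 0 ((of_int \<lceil>real n * t\<rceil> - 1) / real n)"
    have "of_int \<lceil>real n * t\<rceil> - 1 < real n * t" by linarith
    then have b: "?b < t" using t n by (simp add: pos_divide_less_eq mult.commute[of t])
    have "\<forall>\<^sub>F y in at_left t. ?f y = g (nat (\<lceil>real n * t\<rceil> - 1))"
      unfolding eventually_at_left[OF b]
    proof (intro exI[of _ ?b] conjI allI impI b)
      fix y assume y: "?b < y" "y < t"
      have "real n * y < real n * t" using y n by simp
      moreover have "of_int \<lceil>real n * t\<rceil> - 1 < real n * y"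
        using y n by (simp add: pos_divide_less_eq mult.commute)
      ultimately have "\<lfloor>real n * y\<rfloor> = \<lceil>real n * t\<rceil> - 1" by (intro floor_unique) (simp, linarith+)
      then show "?f y = g (nat (\<lceil>real n * t\<rceil> - 1))" using y t by simp
    qed
    then show ?thesis using tendsto_eventually by blast
  qed
  show ?thesis unfolding skorokhod_D0_def using right left assms by simp
qed

lemma continuous_path_in_skorokhod_D0:
  fixes h :: "real \<Rightarrow> 'v::real_normed_vector"
  assumes "\<And>t. isCont h t" "h 0 = 0"
  shows "(\<lambda>t\<in>{0..1}. h t) \<in> skorokhod_D0"
proof -
  have lim: "(h \<longlongrightarrow> h t) (at t within A)" for t A
    using tendsto_within_subset[OF assms(1)[of t, unfolded isCont_def]] by simp
  have "((\<lambda>t\<in>{0..1}. h t) \<longlongrightarrow> h t) (at_right t)" if "t \<in> {0..<1}" for t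
  proof (rule Lim_transform_eventually[OF lim])
    show "\<forall>\<^sub>F s in at_right t. h s = (\<lambda>t\<in>{0..1}. h t) s"
      using that unfolding eventually_at_right_field by (intro exI[of _ 1]) auto
  qed
  moreover have "((\<lambda>t\<in>{0..1}. h t) \<longlongrightarrow> h t) (at_left t)" if "t \<in> {0<..1}" for t
  proof (rule Lim_transform_eventually[OF lim])
    show "\<forall>\<^sub>F s in at_left t. h s = (\<lambda>t\<in>{0..1}. h t) s"
      using that unfolding eventually_at_left_field by (intro exI[of _ 0]) auto
  qed
  then have "\<exists>l. ((\<lambda>t\<in>{0..1}. h t) \<longlongrightarrow> l) (at_left t)" if "t \<in> {0<..1}" for t
    using that by blast
  ultimately show ?thesis unfolding skorokhod_D0_def using assms(2) by simp
qed

section \<open>Comparison of the Skorokhod and uniform distances\<close>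

lemma id_in_time_changes: "(\<lambda>t. t) \<in> time_changes"
  by (auto simp: time_changes_def strict_mono_on_def)

text \<open>A real supremum dominates its members only for sets bounded above, so boundedness by 1
  comes first; then the value at 0 suffices.\<close>

lemma sup_norm_time_change_nonneg:
  assumes "\<tau> \<in> time_changes"
  shows "0 \<le> sup_norm (\<lambda>t. \<tau> t - t)"
proof -
  have "\<tau> t \<in> {0..1}" if "t \<in> {0..1}" for t
    using assms that unfolding time_changes_def by blast
  then have "bdd_above ((\<lambda>t. norm (\<tau> t - t)) ` {0..1})"
    by (intro bdd_aboveI2[where M=1]) (force simp: abs_le_iff)
  then have "norm (\<tau> 0 - 0) \<le> sup_norm (\<lambda>t. \<tau> t - t)"
    unfolding sup_norm_def by (intro cSUP_upper) auto
  then show ?thesis by (rule order_trans[OF norm_ge_zero])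
qed

text \<open>The time-change entry alone makes every maximum nonnegative, whatever the supremum of
  the other entry evaluates to.\<close>

lemma skorokhod_dist_nonneg: "0 \<le> skorokhod_dist f g"
  unfolding skorokhod_dist_def using id_in_time_changes sup_norm_time_change_nonneg
  by (intro cINF_greatest) (auto simp: le_max_iff_disj)

text \<open>The identity time change shows that a uniform bound is a Skorokhod bound.\<close>

lemma skorokhod_dist_le:
  assumes "\<And>t. t \<in> {0..1} \<Longrightarrow> norm (f t - g t) \<le> B"
  shows "skorokhod_dist f g \<le> B"
proof -
  have B: "0 \<le> B" using order_trans[OF norm_ge_zero assms[of 0]] by simp
  have "sup_norm (\<lambda>t. f t - g t) \<le> B"
    unfolding sup_norm_def by (intro cSUP_least) (use assms in auto)
  moreover have "sup_norm (\<lambda>t. t - t :: real) = 0"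
    by (simp add: sup_norm_def)
  moreover have "skorokhod_dist f g \<le> max (sup_norm (\<lambda>t. t - t :: real)) (sup_norm (\<lambda>t. f t - g t))"
    unfolding skorokhod_dist_def
    by (rule cINF_lower[OF bdd_belowI2[where m=0] id_in_time_changes])
      (use sup_norm_time_change_nonneg in \<open>auto simp: le_max_iff_disj\<close>)
  ultimately show ?thesis using B by simp
qed

section \<open>Averaging the error and passing to the paths\<close>

text \<open>The constant absorbs the finitely many early terms. A bound for every index is needed
  because the averages include small \<open>i\<close>, and the index
  \<open>\<lfloor>n t\<rfloor>\<close> is small for \<open>t\<close> near 0 even when
  \<open>n\<close> is large.\<close>

lemma sublinear_bound:
  fixes v :: "nat \<Rightarrow> 'v::real_normed_vector"
  assumes "(\<lambda>n. (1 / real n) *\<^sub>R v n) \<longlonglongrightarrow> 0" "\<epsilon> > 0"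
  obtains C where "C \<ge> 0" "\<And>n. norm (v n) \<le> \<epsilon> * real n + C"
proof -
  obtain n0 where n0: "\<And>n. n \<ge> n0 \<Longrightarrow> norm ((1 / real n) *\<^sub>R v n) < \<epsilon>"
    using LIMSEQ_D[OF assms] by auto
  define C where "C = (\<Sum>n\<le>n0. norm (v n))"
  have C: "C \<ge> 0" unfolding C_def by (intro sum_nonneg) auto
  have "norm (v n) \<le> \<epsilon> * real n + C" for n
  proof (cases "n \<le> n0")
    case True
    then have "norm (v n) \<le> C" unfolding C_def by (intro member_le_sum) auto
    moreover have "0 \<le> \<epsilon> * real n" using assms by simp
    ultimately show ?thesis by linarith
  next
    case False
    then have "real n > 0" "norm (v n) / real n < \<epsilon>" using n0[of n] by (auto simp: divide_inverse_commute)
    then have "norm (v n) \<le> \<epsilon> * real n" by (simp add: pos_divide_less_eq)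
    then show ?thesis using C by linarith
  qed
  then show thesis using that C by blast
qed

lemma norm_sum_le_of_sublinear:
  fixes v :: "nat \<Rightarrow> 'v::real_normed_vector"
  assumes "\<And>i. norm (v i) \<le> \<epsilon> * real i + C" "\<epsilon> \<ge> 0"
  shows "norm (\<Sum>i=1..n. v i) \<le> real n * (\<epsilon> * real n + C)"
proof -
  have "norm (v i) \<le> \<epsilon> * real n + C" if "i \<in> {1..n}" for i
    using assms(1)[of i] mult_left_mono[of "real i" "real n" \<epsilon>] assms(2) that by auto
  then have "norm (\<Sum>i=1..n. v i) \<le> of_nat (card {1..n}) * (\<epsilon> * real n + C)"
    by (rule sum_norm_bound)
  then show ?thesis by simp
qed

text \<open>Averaging \<open>i * \<mu>\<close> over \<open>i = 1..n\<close> gives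
  \<open>(n + 1) / 2 * \<mu>\<close>, so the excess over \<open>n / 2 * \<mu>\<close> is the
  constant \<open>\<mu> / 2\<close>, while averaging the errors preserves a bound
  \<open>\<epsilon> * n + C\<close>.\<close>

lemma center_of_mass_asymptotics:
  fixes X :: "nat \<Rightarrow> 'w \<Rightarrow> 'v::real_normed_vector"
  assumes lim: "(\<lambda>n. (1 / real n) *\<^sub>R random_walk X n \<omega>) \<longlonglongrightarrow> \<mu>" and "\<epsilon> > 0"
  obtains C where "C \<ge> 0"
    "\<And>n. norm (center_of_mass X n \<omega> - (real n / 2) *\<^sub>R \<mu>) \<le> \<epsilon> * real n + C"
proof -
  define v where "v n = random_walk X n \<omega> - real n *\<^sub>R \<mu>" for n
  have "(\<lambda>n. (1 / real n) *\<^sub>R random_walk X n \<omega> - \<mu>) \<longlonglongrightarrow> 0"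
    using lim by (simp add: LIM_zero_iff)
  \<comment> \<open>At \<open>n = 0\<close> the convention \<open>1 / 0 = 0\<close> turns the left
    side into \<open>- \<mu>\<close> and the right side into 0, so equality is claimed only
    eventually.\<close>
  moreover have "\<forall>\<^sub>F n in sequentially. (1 / real n) *\<^sub>R random_walk X n \<omega> - \<mu> = (1 / real n) *\<^sub>R v n"
    using eventually_gt_at_top[of 0] by eventually_elim (simp add: v_def scaleR_diff_right)
  ultimately have "(\<lambda>n. (1 / real n) *\<^sub>R v n) \<longlonglongrightarrow> 0"
    by (rule Lim_transform_eventually)
  then obtain C where C: "C \<ge> 0" "\<And>n. norm (v n) \<le> \<epsilon> * real n + C"
    using sublinear_bound[OF _ \<open>\<epsilon> > 0\<close>] by blast
  have "norm (center_of_mass X n \<omega> - (real n / 2) *\<^sub>R \<mu>) \<le> \<epsilon> * real n + (C + norm \<mu> / 2)" for n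
  proof (cases "n = 0")
    case True
    then show ?thesis using C by (simp add: center_of_mass_def)
  next
    case False
    have gauss: "(\<Sum>i=1..n. real i) = real n * ((real n + 1) / 2)"
      by (induction n) (auto simp: field_simps)
    have "(\<Sum>i=1..n. random_walk X i \<omega>) = (\<Sum>i=1..n. v i) + (\<Sum>i=1..n. real i) *\<^sub>R \<mu>"
      by (simp add: v_def sum_subtractf scaleR_left.sum)
    then have "center_of_mass X n \<omega> = (1 / real n) *\<^sub>R (\<Sum>i=1..n. v i) + ((real n + 1) / 2) *\<^sub>R \<mu>"
      using False unfolding gauss by (simp add: center_of_mass_def scaleR_add_right)
    then have "center_of_mass X n \<omega> - (real n / 2) *\<^sub>R \<mu> = (1 / real n) *\<^sub>R (\<Sum>i=1..n. v i) + (1 / 2) *\<^sub>R \<mu>"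
      by (simp add: add_divide_distrib scaleR_add_left)
    then have "norm (center_of_mass X n \<omega> - (real n / 2) *\<^sub>R \<mu>)
        \<le> norm ((1 / real n) *\<^sub>R (\<Sum>i=1..n. v i)) + norm ((1 / 2) *\<^sub>R \<mu>)"
      by (simp only: norm_triangle_ineq)
    also have "\<dots> = norm (\<Sum>i=1..n. v i) / real n + norm \<mu> / 2" by simp
    also have "norm (\<Sum>i=1..n. v i) / real n \<le> \<epsilon> * real n + C"
      using norm_sum_le_of_sublinear[OF C(2), of n] \<open>\<epsilon> > 0\<close> False by (simp add: pos_divide_le_eq mult.commute)
    finally show ?thesis by simp
  qed
  then show thesis using that[of "C + norm \<mu> / 2"] C by simp
qed

lemma com_path_tendsto_linear_path:
  fixes X :: "nat \<Rightarrow> 'w \<Rightarrow> 'v::real_normed_vector"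
  assumes lim: "(\<lambda>n. (1 / real n) *\<^sub>R random_walk X n \<omega>) \<longlonglongrightarrow> \<mu>"
  shows "(\<lambda>n. skorokhod_dist (com_path X n \<omega>) (\<lambda>t\<in>{0..1}. (1 / 2) *\<^sub>R linear_path \<mu> t)) \<longlonglongrightarrow> 0"
proof (rule LIMSEQ_I)
  fix r :: real assume r: "r > 0"
  obtain C where C: "C \<ge> 0"
      "\<And>n. norm (center_of_mass X n \<omega> - (real n / 2) *\<^sub>R \<mu>) \<le> r / 4 * real n + C"
    using center_of_mass_asymptotics[OF lim, of "r / 4"] r by auto
  \<comment> \<open>The extra \<open>norm \<mu> / 2\<close> pays for replacing
    \<open>real n * t\<close> by its floor, an error of at most 1 before halving.\<close>
  define C' where "C' = C + norm \<mu> / 2"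
  have dist: "skorokhod_dist (com_path X n \<omega>) (\<lambda>t\<in>{0..1}. (1 / 2) *\<^sub>R linear_path \<mu> t) \<le> r / 4 + C' / real n"
    if "n \<ge> 1" for n
  proof (rule skorokhod_dist_le)
    fix t :: real assume t: "t \<in> {0..1}"
    define k where "k = nat \<lfloor>real n * t\<rfloor>"
    have n: "real n > 0" using that by simp
    have nt: "0 \<le> real n * t" "real n * t \<le> real n" using t n by (auto simp: mult_left_le)
    have k: "real k \<le> real n * t" "real n * t \<le> real k + 1" "real k \<le> real n"
      using nt unfolding k_def by linarith+
    define c where "c = center_of_mass X k \<omega>"
    have "com_path X n \<omega> t - (1 / 2) *\<^sub>R linear_path \<mu> t = (1 / real n) *\<^sub>R c - (t / 2) *\<^sub>R \<mu>"
      using t by (simp add: com_path_def linear_path_def k_def c_def)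
    also have "(t / 2) *\<^sub>R \<mu> = (1 / real n) *\<^sub>R (real n * t / 2) *\<^sub>R \<mu>" using n by simp
    \<comment> \<open>Recentring at \<open>(k / 2) * \<mu>\<close> separates the error of the centre
      of mass from the rounding error.\<close>
    also have "(1 / real n) *\<^sub>R c - \<dots> = (1 / real n) *\<^sub>R ((c - (real k / 2) *\<^sub>R \<mu>) - ((real n * t - real k) / 2) *\<^sub>R \<mu>)"
      by (simp only: scaleR_diff_right[symmetric] diff_divide_distrib scaleR_diff_left) simp
    finally have "norm (com_path X n \<omega> t - (1 / 2) *\<^sub>R linear_path \<mu> t)
        = norm ((c - (real k / 2) *\<^sub>R \<mu>) - ((real n * t - real k) / 2) *\<^sub>R \<mu>) / real n"
      by simp
    also have "\<dots> \<le> (r / 4 * real n + C') / real n"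
    proof (rule divide_right_mono)
      have "norm (((real n * t - real k) / 2) *\<^sub>R \<mu>) = (real n * t - real k) / 2 * norm \<mu>"
        using k by simp
      also have "\<dots> \<le> 1 / 2 * norm \<mu>" using k by (intro mult_right_mono) auto
      finally have 1: "norm (((real n * t - real k) / 2) *\<^sub>R \<mu>) \<le> norm \<mu> / 2" by simp
      have "r / 4 * real k \<le> r / 4 * real n" using k r by simp
      then have 2: "norm (c - (real k / 2) *\<^sub>R \<mu>) \<le> r / 4 * real n + C"
        using C(2)[of k] unfolding c_def by linarith
      show "norm ((c - (real k / 2) *\<^sub>R \<mu>) - ((real n * t - real k) / 2) *\<^sub>R \<mu>) \<le> r / 4 * real n + C'"
        using 1 2 norm_triangle_ineq4[of "c - (real k / 2) *\<^sub>R \<mu>" "((real n * t - real k) / 2) *\<^sub>R \<mu>"]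
        unfolding C'_def by linarith
    qed simp
    also have "\<dots> = r / 4 + C' / real n" using n by (simp add: add_divide_distrib)
    finally show "norm (com_path X n \<omega> t - (\<lambda>t\<in>{0..1}. (1 / 2) *\<^sub>R linear_path \<mu> t) t) \<le> r / 4 + C' / real n"
      using t by simp
  qed
  \<comment> \<open>Beyond \<open>n0\<close> the remainder \<open>C' / real n\<close> is below
    \<open>r / 4\<close>, so the distance stays below \<open>r / 2\<close>.\<close>
  obtain n0 where n0: "C' / (r / 4) < real n0" using reals_Archimedean2 by blast
  have "norm (skorokhod_dist (com_path X n \<omega>) (\<lambda>t\<in>{0..1}. (1 / 2) *\<^sub>R linear_path \<mu> t) - 0) < r"
    if "n \<ge> max 1 n0" for n
  proof -
    have "C' / (r / 4) < real n" using n0 that by (simp add: order_less_le_trans)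
    then have "C' / real n < r / 4" using r that by (simp add: field_simps)
    moreover have "1 \<le> n" using that by simp
    ultimately have "skorokhod_dist (com_path X n \<omega>) (\<lambda>t\<in>{0..1}. (1 / 2) *\<^sub>R linear_path \<mu> t) < r"
      using dist[of n] r by linarith
    then show ?thesis by (simp add: skorokhod_dist_nonneg)
  qed
  then show "\<exists>n0. \<forall>n\<ge>n0. norm (skorokhod_dist (com_path X n \<omega>)
      (\<lambda>t\<in>{0..1}. (1 / 2) *\<^sub>R linear_path \<mu> t) - 0) < r" by blast
qed

text \<open>Since \<open>skorokhod_dist\<close> is total, convergence of its values does not by
  itself place the paths and the limit in the space; the first two conjuncts do.\<close>

theorem theorem7p8:
  fixes M :: "'w measure"
    and \<xi> :: "'w \<Rightarrow> real ^ 'd"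
    and X :: "nat \<Rightarrow> 'w \<Rightarrow> real ^ 'd"
    and \<mu> :: "real ^ 'd"
  assumes "prob_space M"
    and "\<xi> \<in> borel_measurable M"
    and "prob_space.indep_vars M (\<lambda>_. borel) X {1..}"
    and "\<And>i. i \<ge> 1 \<Longrightarrow> distr M borel (X i) = distr M borel \<xi>"
    and "integrable M (\<lambda>\<omega>. norm (\<xi> \<omega>))"
    and "integral\<^sup>L M \<xi> = \<mu>"
  shows "(\<forall>n\<ge>1. \<forall>\<omega>\<in>space M. com_path X n \<omega> \<in> skorokhod_D0) \<and>
    (\<lambda>t\<in>{0..1}. (1 / 2) *\<^sub>R linear_path \<mu> t) \<in> skorokhod_D0 \<and>
    (AE \<omega> in M. (\<lambda>n. skorokhod_dist (com_path X n \<omega>)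
        (\<lambda>t\<in>{0..1}. (1 / 2) *\<^sub>R linear_path \<mu> t)) \<longlonglongrightarrow> 0)"
proof (intro conjI ballI allI impI)
  interpret prob_space M by fact
  show "com_path X n \<omega> \<in> skorokhod_D0" if "n \<ge> 1" for n \<omega>
    unfolding com_path_def by (rule step_path_in_skorokhod_D0[OF that]) (simp add: center_of_mass_def)
  have "(\<lambda>t\<in>{0..1}. (1 / 2) *\<^sub>R linear_path \<mu> t) = (\<lambda>t\<in>{0..1}. (t / 2) *\<^sub>R \<mu>)"
    by (auto simp: linear_path_def fun_eq_iff)
  also have "\<dots> \<in> skorokhod_D0"
    by (rule continuous_path_in_skorokhod_D0) (auto intro!: continuous_intros)
  finally show "(\<lambda>t\<in>{0..1}. (1 / 2) *\<^sub>R linear_path \<mu> t) \<in> skorokhod_D0" .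
  have "integrable M \<xi>" using assms(2,5) by (simp add: integrable_norm_iff)
  then have "AE \<omega> in M. (\<lambda>n. (1 / real n) *\<^sub>R random_walk X n \<omega>) \<longlonglongrightarrow> \<mu>"
    using strong_law[OF assms(3) _ assms(4)] assms(6) by (simp add: random_walk_def)
  then show "AE \<omega> in M. (\<lambda>n. skorokhod_dist (com_path X n \<omega>)
      (\<lambda>t\<in>{0..1}. (1 / 2) *\<^sub>R linear_path \<mu> t)) \<longlonglongrightarrow> 0"
    by eventually_elim (rule com_path_tendsto_linear_path)
qed

end
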